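(* Let $\phi$ be a continuous flow of a compact metric space $X$ and let $\mu$ be a Borel measure of $X$. Then the following properties hold: (A1) If $\mu$ is expansive for $\phi$, then $\operatorname{supp}(\mu)\cap Sing(\phi)=\emptyset$. (A2) If $\mu$ is expansive for $\phi$, then $\phi$ is aperiodic with respect to $\mu$. (A3) If $\psi$ is a continuous flow on a metric space $Y$ and $f:X\to Y$ is an equivalence between $\phi$ and $\psi$, then $\mu$ is expansive for $\phi$ if and only if $f_*\mu$ is expansive for $\psi$. (A4) If $\mu$ is expansive for $\phi$, then $\mu$ vanishes along the orbits of $\phi$. (A5) If $\phi$ is expansive, then every Borel measure of $X$ vanishing along the orbits of $\phi$ is expansive for $\phi$.
   Context: Let $(X,d)$ be a metric space. A flow of $X$ is a map $\phi:\mathbb{R}\times X\to X$, written $\phi_t(x)=\phi(t,x)$, with $\phi_0(x)=x$ and $\phi(t,\phi(s,x))=\phi(t+s,x)$ for all $s,t\in\mathbb{R}$, $x\in X$; it is continuous if it is continuous as a map $\mathbb{R}\times X\to X$. For $I\subset\mathbb{R}$, $\phi_I(x)=\{\phi_t(x):t\in I\}$; $\phi_{\mathbb{R}}(x)$ is the orbit of $x$. $\mathcal{B}$ denotes the set of continuous maps $h:\mathbb{R}\to\mathbb{R}$ with $h(0)=0$. $B[x,\delta]$ is the closed ball. For $\delta>0$ and $x\in X$, $\Gamma_\delta(x)=\bigcup_{h\in\mathcal{B}}\bigcap_{t\in\mathbb{R}}\phi_{-h(t)}(B[\phi_t(x),\delta])$, i.e. $y\in\Gamma_\delta(x)$ iff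 there is $h\in\mathcal{B}$ with $d(\phi_t(x),\phi_{h(t)}(y))\le\delta$ for all $t\in\mathbb{R}$. A Borel measure is a non-negative $\sigma$-additive map on the Borel $\sigma$-algebra of $X$. For an arbitrary subset $B\subset X$ one writes $\mu(B)=0$ if $\mu(A)=0$ for every Borel set $A\subset B$. A Borel measure $\mu$ is expansive for $\phi$ if there is $\delta>0$ such that $\mu(\Gamma_\delta(x))=0$ for every $x\in X$. The flow $\phi$ is expansive if for every $\epsilon>0$ there is $\delta>0$ such that if $x,y\in X$ satisfy $d(\phi_t(x),\phi_{h(t)}(y))\le\delta$ for every $t\in\mathbb{R}$ and some $h\in\mathcal{B}$, then $y\in\phi_{(-\epsilon,\epsilon)}(x)$. $Sing(\phi)$ is the set of singularities, i.e. points $x$ with $\phi_t(x)=x$ for every $t\in\mathbb{R}$. $Per(\phi)$ is the set of periodic points, i.e. points $x$ for which there is a minimal $t>0$ with $\phi_t(x)=x$. $\operatorname{supp}(\mu)$ is the support of $\mu$ (points all of whose neighborhoods have positive measure). $\phi$ is aperiodic with respect to $\mu$ if $\mu(Per(\phi))=0$. $\mu$ vanishes along the orbits of $\phi$ if $\mu(\phi_{\mathbb{R}}(x))=0$ for every $x\in X$. For a Borel measurable $f:X\to Y$, $f_*\mu=\mu\circ f^{-1}$. An equivalence between continuous flows $\phi$ on $X$ and $\psi$ on $Y$ is a homeomorphism $f:X\to Y$ carrying the orbits of $\phi$ onto orbits of $\psi$. *)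

theory Defs
  imports "HOL-Analysis.Analysis"
begin

definition flow :: "(real \<Rightarrow> 'a \<Rightarrow> 'a) \<Rightarrow> bool" where
  "flow \<phi> \<longleftrightarrow> (\<forall>x. \<phi> 0 x = x) \<and> (\<forall>t s x. \<phi> t (\<phi> s x) = \<phi> (t + s) x)"

definition continuous_flow :: "(real \<Rightarrow> 'a \<Rightarrow> 'a::metric_space) \<Rightarrow> bool" where
  "continuous_flow \<phi> \<longleftrightarrow> flow \<phi> \<and> continuous_on UNIV (\<lambda>(t, x). \<phi> t x)"

definition flow_seg :: "(real \<Rightarrow> 'a \<Rightarrow> 'a) \<Rightarrow> real set \<Rightarrow> 'a \<Rightarrow> 'a set" where
  "flow_seg \<phi> I x = {\<phi> t x | t. t \<in> I}"

abbreviation flow_orbit :: "(real \<Rightarrow> 'a \<Rightarrow> 'a) \<Rightarrow> 'a \<Rightarrow> 'a set" where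
  "flow_orbit \<phi> x \<equiv> flow_seg \<phi> UNIV x"

text \<open>The elements of the following set are not required to be monotone or surjective.\<close>

definition time_changes :: "(real \<Rightarrow> real) set" where
  "time_changes = {h. continuous_on UNIV h \<and> h 0 = 0}"

definition Gamma_set :: "(real \<Rightarrow> 'a \<Rightarrow> 'a::metric_space) \<Rightarrow> real \<Rightarrow> 'a \<Rightarrow> 'a set" where
  "Gamma_set \<phi> \<delta> x = (\<Union>h\<in>time_changes. \<Inter>t. \<phi> (- h t) ` cball (\<phi> t x) \<delta>)"

text \<open>Borel measures may be infinite, and need not be \<open>\<sigma>\<close>-finite.\<close>

definition borel_measure :: "'a::topological_space measure \<Rightarrow> bool" where
  "borel_measure \<mu> \<longleftrightarrow> sets \<mu> = sets borel"

text \<open>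
  \<open>\<mu>(B) = 0\<close> for an arbitrary, possibly non-measurable set \<open>B\<close>. Note that \<open>emeasure \<mu> B = 0\<close>
  is not the right notion, since it holds by convention for every non-measurable \<open>B\<close>.
\<close>

definition measure_zero :: "'a::topological_space measure \<Rightarrow> 'a set \<Rightarrow> bool" where
  "measure_zero \<mu> B \<longleftrightarrow> (\<forall>A\<in>sets borel. A \<subseteq> B \<longrightarrow> emeasure \<mu> A = 0)"

definition expansive_measure :: "(real \<Rightarrow> 'a \<Rightarrow> 'a::metric_space) \<Rightarrow> 'a measure \<Rightarrow> bool" where
  "expansive_measure \<phi> \<mu> \<longleftrightarrow> (\<exists>\<delta>>0. \<forall>x. measure_zero \<mu> (Gamma_set \<phi> \<delta> x))"

definition expansive_flow :: "(real \<Rightarrow> 'a \<Rightarrow> 'a::metric_space) \<Rightarrow> bool" where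
  "expansive_flow \<phi> \<longleftrightarrow>
     (\<forall>\<epsilon>>0. \<exists>\<delta>>0. \<forall>x y.
        (\<exists>h\<in>time_changes. \<forall>t. dist (\<phi> t x) (\<phi> (h t) y) \<le> \<delta>)
        \<longrightarrow> y \<in> flow_seg \<phi> {-\<epsilon><..<\<epsilon>} x)"

definition Sing :: "(real \<Rightarrow> 'a \<Rightarrow> 'a) \<Rightarrow> 'a set" where
  "Sing \<phi> = {x. \<forall>t. \<phi> t x = x}"

text \<open>A minimal positive period is required, so singularities are not periodic.\<close>

definition Per :: "(real \<Rightarrow> 'a \<Rightarrow> 'a) \<Rightarrow> 'a set" where
  "Per \<phi> = {x. \<exists>t>0. \<phi> t x = x \<and> (\<forall>s. 0 < s \<and> s < t \<longrightarrow> \<phi> s x \<noteq> x)}"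

definition supp :: "'a::topological_space measure \<Rightarrow> 'a set" where
  "supp \<mu> = {x. \<forall>U. open U \<and> x \<in> U \<longrightarrow> emeasure \<mu> U > 0}"

definition aperiodic_wrt :: "(real \<Rightarrow> 'a \<Rightarrow> 'a::topological_space) \<Rightarrow> 'a measure \<Rightarrow> bool" where
  "aperiodic_wrt \<phi> \<mu> \<longleftrightarrow> measure_zero \<mu> (Per \<phi>)"

definition vanishes_along_orbits ::
    "(real \<Rightarrow> 'a \<Rightarrow> 'a::topological_space) \<Rightarrow> 'a measure \<Rightarrow> bool" where
  "vanishes_along_orbits \<phi> \<mu> \<longleftrightarrow> (\<forall>x. measure_zero \<mu> (flow_orbit \<phi> x))"

text \<open>Equivalences need not respect the time direction of the orbits.\<close>

definition flow_equivalence ::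
    "(real \<Rightarrow> 'a \<Rightarrow> 'a::metric_space) \<Rightarrow> (real \<Rightarrow> 'b \<Rightarrow> 'b::metric_space) \<Rightarrow> ('a \<Rightarrow> 'b) \<Rightarrow> bool" where
  "flow_equivalence \<phi> \<psi> f \<longleftrightarrow>
     (\<exists>g. homeomorphism UNIV UNIV f g) \<and>
     (\<forall>x. \<exists>y. f ` flow_orbit \<phi> x = flow_orbit \<psi> y)"

end

theory Submission
  imports Defs
begin

text \<open>
  Everything rests on exhibiting suitable time changes. For an expansive measure, a singularity
  in the support is excluded by the zero time change (\<open>expansive_supp_Sing\<close>), and orbits are null
  because points on the same orbit with a small time lag shadow each other under the identity
  (\<open>expansive_vanishes_along_orbits\<close>). Two nearby points with nearly equal periods shadow each
  other under the linear time change that matches the periods (\<open>periodic_mem_Gamma_set\<close>), and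
  compactness then cuts the set of periodic points into countably many Borel null pieces
  (\<open>expansive_aperiodic\<close>). For an expansive flow, shadowing points share an orbit, which gives the
  last claim.

  The substantial claim is invariance under equivalence. An equivalence \<open>f\<close> respects orbits only
  as sets, so that a reparametrisation has to be recovered: for each \<open>x\<close> there is a continuous
  \<open>b\<close> with \<open>b 0 = 0\<close> and \<open>f (\<phi> t x) = \<psi> (b t) (f x)\<close> (\<open>flow_equivalence_time\<close>). More generally,
  any continuous path in one orbit is followed with a continuous time (\<open>lift_path_in_orbit\<close>). This
  is not automatic, as a recurrent orbit carries a coarser topology than its time axis. On a
  periodic orbit, a circle, the time is a continuous logarithm. On an orbit without returns, the
  path could leave the given arc only by splitting an interval into countably many, and at least
  two, disjoint nonempty closed sets, which Sierpinski's theorem forbids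
  (\<open>orbit_time_locally_bounded\<close>). Composing these times with the time changes that witness
  shadowing carries \<^const>\<open>Gamma_set\<close> of one flow into that of the other, and uniform continuity
  adjusts the distances.
\<close>

section \<open>Elementary facts about flows and null sets\<close>

lemma flow_0: "flow \<phi> \<Longrightarrow> \<phi> 0 x = x"
  by (simp add: flow_def)

lemma flow_add: "flow \<phi> \<Longrightarrow> \<phi> t (\<phi> s x) = \<phi> (t + s) x"
  by (simp add: flow_def)

lemma flow_cancel:
  assumes "flow \<phi>" and "\<phi> t x = \<phi> s y"
  shows "\<phi> (t - s) x = y"
proof -
  have "\<phi> (t - s) x = \<phi> (- s) (\<phi> t x)"
    using assms(1) by (simp add: flow_add)
  also have "\<dots> = y"
    using assms by (simp add: flow_add flow_0)
  finally show ?thesis .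
qed

lemma continuous_flow_compose:
  assumes "continuous_flow \<phi>" and "continuous_on S f" and "continuous_on S g"
  shows "continuous_on S (\<lambda>x. \<phi> (f x) (g x))"
proof -
  have "continuous_on UNIV (\<lambda>(t, x). \<phi> t x)"
    using assms(1) by (simp add: continuous_flow_def)
  from continuous_on_compose2[OF this continuous_on_Pair[OF assms(2,3)]]
  show ?thesis by simp
qed

lemma orbit_eqI:
  assumes "flow \<phi>" and "y \<in> flow_orbit \<phi> x"
  shows "flow_orbit \<phi> x = flow_orbit \<phi> y"
proof -
  obtain s where y: "y = \<phi> s x"
    using assms(2) by (auto simp: flow_seg_def)
  have "\<phi> t x = \<phi> (t - s) y" "\<phi> t y = \<phi> (t + s) x" for t
    using assms(1) by (simp_all add: y flow_add)
  then show ?thesis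
    unfolding flow_seg_def by blast
qed

lemma mem_Gamma_set_iff:
  assumes "flow \<phi>"
  shows "y \<in> Gamma_set \<phi> \<delta> x \<longleftrightarrow>
    (\<exists>h\<in>time_changes. \<forall>t. dist (\<phi> t x) (\<phi> (h t) y) \<le> \<delta>)"
proof -
  have "y \<in> \<phi> (- s) ` cball (\<phi> t x) \<delta> \<longleftrightarrow> dist (\<phi> t x) (\<phi> s y) \<le> \<delta>" for s t
  proof
    assume "y \<in> \<phi> (- s) ` cball (\<phi> t x) \<delta>"
    then show "dist (\<phi> t x) (\<phi> s y) \<le> \<delta>"
      using assms by (auto simp: flow_add flow_0)
  next
    assume "dist (\<phi> t x) (\<phi> s y) \<le> \<delta>"
    moreover have "y = \<phi> (- s) (\<phi> s y)"
      using assms by (simp add: flow_add flow_0)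
    ultimately show "y \<in> \<phi> (- s) ` cball (\<phi> t x) \<delta>"
      by (metis image_eqI mem_cball)
  qed
  then show ?thesis
    by (auto simp: Gamma_set_def)
qed

lemma measure_zero_mono: "measure_zero \<mu> B \<Longrightarrow> A \<subseteq> B \<Longrightarrow> measure_zero \<mu> A"
  unfolding measure_zero_def by blast

text \<open>
  Inner nullity in the sense of \<^const>\<open>measure_zero\<close> is not countably subadditive on arbitrary
  sets, which is why the covering sets have to be Borel.
\<close>

lemma measure_zero_countable_cover:
  assumes "borel_measure \<mu>" and "countable I"
    and "\<And>i. i \<in> I \<Longrightarrow> B i \<in> sets borel" and "\<And>i. i \<in> I \<Longrightarrow> measure_zero \<mu> (B i)"
    and "S \<subseteq> (\<Union>i\<in>I. B i)"
  shows "measure_zero \<mu> S"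
  unfolding measure_zero_def
proof (intro ballI impI)
  fix A assume A: "A \<in> sets borel" "A \<subseteq> S"
  have sets: "sets \<mu> = sets borel"
    using assms(1) by (simp add: borel_measure_def)
  have "B i \<in> null_sets \<mu>" if "i \<in> I" for i
    using assms(3,4)[OF that] sets by (auto simp: measure_zero_def null_sets_def)
  then have "(\<Union>i\<in>I. B i) \<in> null_sets \<mu>"
    using assms(2) by (intro null_sets_UN') auto
  then have "A \<in> null_sets \<mu>"
    by (rule null_sets_subset) (use A assms(5) sets in auto)
  then show "emeasure \<mu> A = 0"
    by (simp add: null_setsD1)
qed

section \<open>Uniform continuity over bounded times\<close>

lemma flow_uniformly_continuous:
  fixes \<phi> :: "real \<Rightarrow> 'a::metric_space \<Rightarrow> 'a"
  assumes "compact (UNIV :: 'a set)" and "continuous_flow \<phi>" and "\<delta> > 0"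
  obtains \<rho> where "\<rho> > 0"
    and "\<And>x y s t. \<bar>s\<bar> \<le> b \<Longrightarrow> \<bar>t\<bar> \<le> b \<Longrightarrow> \<bar>s - t\<bar> < \<rho> \<Longrightarrow> dist x y < \<rho> \<Longrightarrow>
           dist (\<phi> s x) (\<phi> t y) < \<delta>"
proof -
  have "continuous_on ({-b..b} \<times> UNIV) (\<lambda>(t, x). \<phi> t x)"
    using assms(2) continuous_on_subset by (fastforce simp: continuous_flow_def)
  then have "uniformly_continuous_on ({-b..b} \<times> UNIV) (\<lambda>(t, x). \<phi> t x)"
    using assms(1) by (intro compact_uniformly_continuous compact_Times) auto
  then obtain r where r: "r > 0"
    "\<And>p q. p \<in> {-b..b} \<times> UNIV \<Longrightarrow> q \<in> {-b..b} \<times> UNIV \<Longrightarrow> dist q p < r \<Longrightarrow>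
      dist ((\<lambda>(t, x). \<phi> t x) q) ((\<lambda>(t, x). \<phi> t x) p) < \<delta>"
    unfolding uniformly_continuous_on_def using assms(3) by meson
  show ?thesis
  proof
    show "r / 2 > 0" using r(1) by simp
    fix x y :: 'a and s t
    assume st: "\<bar>s\<bar> \<le> b" "\<bar>t\<bar> \<le> b" "\<bar>s - t\<bar> < r / 2" "dist x y < r / 2"
    have "dist (s, x) (t, y) \<le> dist s t + dist x y"
      unfolding dist_Pair_Pair by (rule sqrt_sum_squares_le_sum) auto
    then have "dist (s, x) (t, y) < r"
      using st by (simp add: dist_real_def)
    then show "dist (\<phi> s x) (\<phi> t y) < \<delta>"
      using r(2)[of "(t, y)" "(s, x)"] st(1,2) by (auto simp: abs_le_iff)
  qed
qed

text \<open>
  Compactness makes the bound on the displacement independent of the base point, hence of the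
  time already elapsed.
\<close>

lemma flow_small_displacement:
  fixes \<phi> :: "real \<Rightarrow> 'a::metric_space \<Rightarrow> 'a"
  assumes "compact (UNIV :: 'a set)" and "continuous_flow \<phi>" and "\<delta> > 0"
  obtains \<eta> where "\<eta> > 0" and "\<And>x s t. \<bar>s - t\<bar> \<le> \<eta> \<Longrightarrow> dist (\<phi> s x) (\<phi> t x) < \<delta>"
proof -
  have flow: "flow \<phi>" using assms(2) by (simp add: continuous_flow_def)
  obtain \<rho> where \<rho>: "\<rho> > 0"
    "\<And>x y s t. \<bar>s\<bar> \<le> 1 \<Longrightarrow> \<bar>t\<bar> \<le> 1 \<Longrightarrow> \<bar>s - t\<bar> < \<rho> \<Longrightarrow> dist x y < \<rho> \<Longrightarrow>
       dist (\<phi> s x) (\<phi> t y) < \<delta>"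
    using flow_uniformly_continuous[OF assms, where b = 1] by blast
  show ?thesis
  proof
    show "min 1 (\<rho> / 2) > 0" using \<rho>(1) by simp
    fix x s t assume "\<bar>s - t\<bar> \<le> min 1 (\<rho> / 2)"
    then have "dist (\<phi> (s - t) (\<phi> t x)) (\<phi> 0 (\<phi> t x)) < \<delta>"
      using \<rho>(1) by (intro \<rho>(2)) auto
    then show "dist (\<phi> s x) (\<phi> t x) < \<delta>"
      using flow by (simp add: flow_add flow_0)
  qed
qed

section \<open>Singularities, orbits and periodic points of an expansive measure\<close>

text \<open>
  With the constant time change \<open>h = 0\<close> the set \<^term>\<open>Gamma_set \<phi> \<delta> x\<close> of a singularity
  contains a whole ball.
\<close>

lemma expansive_supp_Sing:
  assumes "continuous_flow \<phi>" and "expansive_measure \<phi> \<mu>"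
  shows "supp \<mu> \<inter> Sing \<phi> = {}"
proof (rule ccontr)
  have flow: "flow \<phi>" using assms(1) by (simp add: continuous_flow_def)
  obtain \<delta> where \<delta>: "\<delta> > 0" "\<And>x. measure_zero \<mu> (Gamma_set \<phi> \<delta> x)"
    using assms(2) by (auto simp: expansive_measure_def)
  assume "supp \<mu> \<inter> Sing \<phi> \<noteq> {}"
  then obtain x where x: "x \<in> supp \<mu>" "x \<in> Sing \<phi>" by blast
  have "ball x \<delta> \<subseteq> Gamma_set \<phi> \<delta> x"
  proof
    fix y assume "y \<in> ball x \<delta>"
    moreover have "(\<lambda>_. 0) \<in> time_changes"
      by (simp add: time_changes_def)
    ultimately show "y \<in> Gamma_set \<phi> \<delta> x"
      unfolding mem_Gamma_set_iff[OF flow] using x(2) flow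
      by (intro bexI[of _ "\<lambda>_. 0"]) (auto simp: Sing_def flow_0)
  qed
  then have "emeasure \<mu> (ball x \<delta>) = 0"
    using \<delta>(2)[of x] unfolding measure_zero_def by (metis borel_open open_ball)
  moreover have "emeasure \<mu> (ball x \<delta>) > 0"
    using x(1) \<delta>(1) by (simp add: supp_def)
  ultimately show False by simp
qed

text \<open>
  With \<open>h = id\<close> a short orbit segment through \<open>x\<close> lies in \<^term>\<open>Gamma_set \<phi> \<delta> x\<close>, as the two
  points stay on the same orbit with constant small time lag. Countably many such segments of
  equal length cover the orbit.
\<close>

lemma expansive_vanishes_along_orbits:
  fixes \<phi> :: "real \<Rightarrow> 'a::metric_space \<Rightarrow> 'a"
  assumes "compact (UNIV :: 'a set)" and "continuous_flow \<phi>" and "borel_measure \<mu>"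
    and "expansive_measure \<phi> \<mu>"
  shows "vanishes_along_orbits \<phi> \<mu>"
  unfolding vanishes_along_orbits_def
proof
  fix x
  have flow: "flow \<phi>" using assms(2) by (simp add: continuous_flow_def)
  obtain \<delta> where \<delta>: "\<delta> > 0" "\<And>x. measure_zero \<mu> (Gamma_set \<phi> \<delta> x)"
    using assms(4) by (auto simp: expansive_measure_def)
  obtain \<eta> where \<eta>: "\<eta> > 0" "\<And>x s t. \<bar>s - t\<bar> \<le> \<eta> \<Longrightarrow> dist (\<phi> s x) (\<phi> t x) < \<delta>"
    using flow_small_displacement[OF assms(1,2) \<delta>(1)] by blast
  define B where "B k = (\<lambda>s. \<phi> s x) ` {of_int k * \<eta>..(of_int k + 1) * \<eta>}" for k :: int
  show "measure_zero \<mu> (flow_orbit \<phi> x)"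
  proof (rule measure_zero_countable_cover[OF assms(3), of UNIV B])
    fix k
    have "continuous_on {of_int k * \<eta>..(of_int k + 1) * \<eta>} (\<lambda>s. \<phi> s x)"
      by (intro continuous_flow_compose[OF assms(2)] continuous_intros)
    then show "B k \<in> sets borel"
      unfolding B_def by (intro borel_closed compact_imp_closed compact_continuous_image) auto
    have "B k \<subseteq> Gamma_set \<phi> \<delta> (\<phi> (of_int k * \<eta>) x)"
    proof
      fix y assume "y \<in> B k"
      then obtain s where s: "y = \<phi> s x" "of_int k * \<eta> \<le> s" "s \<le> of_int k * \<eta> + \<eta>"
        by (auto simp: B_def algebra_simps)
      have "dist (\<phi> t (\<phi> (of_int k * \<eta>) x)) (\<phi> t y) \<le> \<delta>" for t
        using \<eta>(2)[of "t + of_int k * \<eta>" "t + s" x] s(2,3)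
        by (simp add: s(1) flow_add[OF flow])
      moreover have "(\<lambda>t. t) \<in> time_changes"
        by (simp add: time_changes_def)
      ultimately show "y \<in> Gamma_set \<phi> \<delta> (\<phi> (of_int k * \<eta>) x)"
        unfolding mem_Gamma_set_iff[OF flow] by (intro bexI[of _ "\<lambda>t. t"] allI)
    qed
    then show "measure_zero \<mu> (B k)"
      by (rule measure_zero_mono[OF \<delta>(2)])
  next
    show "flow_orbit \<phi> x \<subseteq> (\<Union>k\<in>UNIV. B k)"
    proof
      fix y assume "y \<in> flow_orbit \<phi> x"
      then obtain s where s: "y = \<phi> s x" by (auto simp: flow_seg_def)
      have "of_int \<lfloor>s / \<eta>\<rfloor> \<le> s / \<eta>" "s / \<eta> \<le> of_int \<lfloor>s / \<eta>\<rfloor> + 1"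
        by linarith+
      then have "of_int \<lfloor>s / \<eta>\<rfloor> * \<eta> \<le> s" "s \<le> (of_int \<lfloor>s / \<eta>\<rfloor> + 1) * \<eta>"
        using \<eta>(1) pos_le_divide_eq[OF \<eta>(1)] pos_divide_le_eq[OF \<eta>(1)] by blast+
      then show "y \<in> (\<Union>k\<in>UNIV. B k)"
        unfolding B_def s by (intro UN_I[of "\<lfloor>s / \<eta>\<rfloor>"] imageI) simp_all
    qed
  qed auto
qed

lemma flow_period_multiple:
  assumes "flow \<phi>" and "\<phi> T x = x"
  shows "\<phi> (of_int k * T) x = x"
proof -
  have nat: "\<phi> (of_nat n * T) x = x" for n
  proof (induction n)
    case 0
    show ?case using assms(1) by (simp add: flow_0)
  next
    case (Suc n)
    have "\<phi> (of_nat (Suc n) * T) x = \<phi> (of_nat n * T) (\<phi> T x)"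
      using assms(1) by (simp add: flow_add algebra_simps)
    then show ?case using Suc assms(2) by simp
  qed
  show ?thesis
  proof (cases "k \<ge> 0")
    case True
    then show ?thesis using nat[of "nat k"] by simp
  next
    case False
    have "\<phi> 0 x = \<phi> (of_nat (nat (- k)) * T) x"
      using assms(1) nat by (simp add: flow_0)
    from flow_cancel[OF assms(1) this] show ?thesis
      using False by simp
  qed
qed

lemma flow_period_shift:
  assumes "flow \<phi>" and "\<phi> T x = x"
  shows "\<phi> (s + of_int k * T) x = \<phi> s x"
  using flow_period_multiple[OF assms, of k] assms(1) by (metis flow_add)

text \<open>
  The linear time change that turns one period into the other makes two periodic orbits shadow
  each other. Writing \<open>t = k T + r\<close> with \<open>0 \<le> r < T\<close> reduces the estimate to times in one period,
  where the lag \<open>r \<bar>T - T'\<bar> / T\<close> is at most the difference of the periods.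
\<close>

lemma periodic_mem_Gamma_set:
  assumes "flow \<phi>"
    and T: "T > 0" "\<phi> T x = x" and T': "T' > 0" "\<phi> T' y = y"
    and near: "\<And>r. 0 \<le> r \<Longrightarrow> r \<le> T \<Longrightarrow> dist (\<phi> r x) (\<phi> r y) \<le> \<delta> / 2"
    and lag: "\<And>s t. \<bar>s - t\<bar> \<le> \<bar>T - T'\<bar> \<Longrightarrow> dist (\<phi> s y) (\<phi> t y) \<le> \<delta> / 2"
  shows "y \<in> Gamma_set \<phi> \<delta> x"
  unfolding mem_Gamma_set_iff[OF assms(1)]
proof (intro bexI allI)
  show "(\<lambda>t. t * (T' / T)) \<in> time_changes"
    unfolding time_changes_def using T(1) by (auto intro!: continuous_intros)
  fix t
  define k where "k = \<lfloor>t / T\<rfloor>"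
  define r where "r = t - of_int k * T"
  have "of_int k \<le> t / T" "t / T \<le> of_int k + 1"
    unfolding k_def by linarith+
  then have r: "0 \<le> r" "r \<le> T"
    using T(1) by (simp_all add: r_def pos_le_divide_eq pos_divide_le_eq algebra_simps)
  have "\<phi> t x = \<phi> r x"
    using flow_period_shift[OF assms(1) T(2), of r k] by (simp add: r_def)
  moreover have "\<phi> (t * (T' / T)) y = \<phi> (r * (T' / T)) y"
  proof -
    have "t * (T' / T) = r * (T' / T) + of_int k * T'"
      using T(1) by (simp add: r_def field_simps)
    then show ?thesis
      using flow_period_shift[OF assms(1) T'(2)] by simp
  qed
  moreover have "dist (\<phi> r y) (\<phi> (r * (T' / T)) y) \<le> \<delta> / 2"
  proof (rule lag)
    have "r - r * (T' / T) = (r / T) * (T - T')"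
      using T(1) by (simp add: field_simps)
    then have "\<bar>r - r * (T' / T)\<bar> = (r / T) * \<bar>T - T'\<bar>"
      using r(1) T(1) by (simp add: abs_mult)
    also have "\<dots> \<le> 1 * \<bar>T - T'\<bar>"
      using r T(1) by (intro mult_right_mono) auto
    finally show "\<bar>r - r * (T' / T)\<bar> \<le> \<bar>T - T'\<bar>" by simp
  qed
  ultimately show "dist (\<phi> t x) (\<phi> (t * (T' / T)) y) \<le> \<delta>"
    using near[OF r] dist_triangle[of "\<phi> r x" "\<phi> (r * (T' / T)) y" "\<phi> r y"] by simp
qed

text \<open>
  Points having a period in a fixed short interval \<open>[a, a + \<eta>]\<close> form a closed set, and by
  the preceding lemma each sufficiently small piece of it lies in a single
  \<^term>\<open>Gamma_set \<phi> \<delta> x\<close>. Rational values of \<open>a\<close> exhaust all periodic points.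
\<close>

lemma expansive_aperiodic:
  fixes \<phi> :: "real \<Rightarrow> 'a::metric_space \<Rightarrow> 'a"
  assumes "compact (UNIV :: 'a set)" and "continuous_flow \<phi>" and "borel_measure \<mu>"
    and "expansive_measure \<phi> \<mu>"
  shows "aperiodic_wrt \<phi> \<mu>"
  unfolding aperiodic_wrt_def
proof -
  have flow: "flow \<phi>" using assms(2) by (simp add: continuous_flow_def)
  obtain \<delta> where \<delta>: "\<delta> > 0" "\<And>x. measure_zero \<mu> (Gamma_set \<phi> \<delta> x)"
    using assms(4) by (auto simp: expansive_measure_def)
  obtain \<eta> where \<eta>: "\<eta> > 0" "\<And>x s t. \<bar>s - t\<bar> \<le> \<eta> \<Longrightarrow> dist (\<phi> s x) (\<phi> t x) < \<delta> / 2"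
    using flow_small_displacement[OF assms(1,2), of "\<delta> / 2"] \<delta>(1) by auto
  define Q where "Q a = {x. \<exists>T\<in>{a..a + \<eta>}. \<phi> T x = x}" for a
  have closed_Q: "closed (Q a)" for a
  proof -
    have "closed {p. \<phi> (fst p) (snd p) = snd p}"
      by (intro closed_Collect_eq continuous_flow_compose[OF assms(2)] continuous_intros)
    then have "compact ({a..a + \<eta>} \<times> UNIV \<inter> {p. \<phi> (fst p) (snd p) = snd p})"
      using assms(1) by (intro compact_Int_closed compact_Times) auto
    then have "compact (snd ` ({a..a + \<eta>} \<times> UNIV \<inter> {p. \<phi> (fst p) (snd p) = snd p}))"
      by (intro compact_continuous_image continuous_intros)
    moreover have "snd ` ({a..a + \<eta>} \<times> UNIV \<inter> {p. \<phi> (fst p) (snd p) = snd p}) = Q a"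
      unfolding Q_def by force
    ultimately show ?thesis
      by (simp add: compact_imp_closed)
  qed
  have zero_Q: "measure_zero \<mu> (Q a)" if "a > 0" for a
  proof -
    obtain \<rho> where \<rho>: "\<rho> > 0"
      "\<And>x y s t. \<bar>s\<bar> \<le> a + \<eta> \<Longrightarrow> \<bar>t\<bar> \<le> a + \<eta> \<Longrightarrow> \<bar>s - t\<bar> < \<rho> \<Longrightarrow> dist x y < \<rho> \<Longrightarrow>
         dist (\<phi> s x) (\<phi> t y) < \<delta> / 2"
      using flow_uniformly_continuous[OF assms(1,2), of "\<delta> / 2" "a + \<eta>"] \<delta>(1) by auto
    obtain K where K: "finite K" "UNIV \<subseteq> (\<Union>x\<in>K. ball (x::'a) (\<rho> / 2))"
      using seq_compact_imp_totally_bounded[of "UNIV :: 'a set"] assms(1) \<rho>(1)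
      by (metis compact_imp_seq_compact half_gt_zero)
    show ?thesis
    proof (rule measure_zero_countable_cover[OF assms(3), of K "\<lambda>z. Q a \<inter> ball z (\<rho> / 2)"])
      show "countable K" using K(1) by (rule countable_finite)
      fix z
      show "Q a \<inter> ball z (\<rho> / 2) \<in> sets borel"
        using closed_Q[of a] by (intro sets.Int) (auto intro: borel_closed)
      show "measure_zero \<mu> (Q a \<inter> ball z (\<rho> / 2))"
      proof (cases "Q a \<inter> ball z (\<rho> / 2) = {}")
        case True
        then show ?thesis by (simp add: measure_zero_def)
      next
        case False
        then obtain x where x: "x \<in> Q a" "dist z x < \<rho> / 2" by auto
        then obtain T where T: "a \<le> T" "T \<le> a + \<eta>" "\<phi> T x = x" by (auto simp: Q_def)
        have "Q a \<inter> ball z (\<rho> / 2) \<subseteq> Gamma_set \<phi> \<delta> x"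
        proof
          fix y assume y: "y \<in> Q a \<inter> ball z (\<rho> / 2)"
          then obtain T' where T': "a \<le> T'" "T' \<le> a + \<eta>" "\<phi> T' y = y" by (auto simp: Q_def)
          have xy: "dist x y < \<rho>"
            using y x(2) by (auto intro: dist_triangle_half_r)
          show "y \<in> Gamma_set \<phi> \<delta> x"
          proof (rule periodic_mem_Gamma_set[OF flow])
            show "dist (\<phi> r x) (\<phi> r y) \<le> \<delta> / 2" if "0 \<le> r" "r \<le> T" for r
              using \<rho>(2)[of r r x y] that T(2) xy \<rho>(1) by simp
            show "dist (\<phi> s y) (\<phi> t y) \<le> \<delta> / 2" if "\<bar>s - t\<bar> \<le> \<bar>T - T'\<bar>" for s t
              using \<eta>(2)[of s t y] that T T' by linarith
          qed (use T T' \<open>a > 0\<close> in auto)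
        qed
        then show ?thesis
          by (rule measure_zero_mono[OF \<delta>(2)])
      qed
    next
      show "Q a \<subseteq> (\<Union>z\<in>K. Q a \<inter> ball z (\<rho> / 2))"
        using K(2) by blast
    qed
  qed
  show "measure_zero \<mu> (Per \<phi>)"
  proof (rule measure_zero_countable_cover[OF assms(3), of "\<rat> \<inter> {0<..}" Q])
    show "countable (\<rat> \<inter> {0::real<..})"
      by (simp add: countable_Int1 countable_rat)
    show "Per \<phi> \<subseteq> (\<Union>a\<in>\<rat> \<inter> {0<..}. Q a)"
    proof
      fix x assume "x \<in> Per \<phi>"
      then obtain T where T: "T > 0" "\<phi> T x = x" by (auto simp: Per_def)
      obtain a where a: "a \<in> \<rat>" "max 0 (T - \<eta>) < a" "a < T"
        using Rats_dense_in_real[of "max 0 (T - \<eta>)" T] T(1) \<eta>(1) by auto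
      then have "x \<in> Q a"
        using T(2) unfolding Q_def by force
      then show "x \<in> (\<Union>a\<in>\<rat> \<inter> {0<..}. Q a)"
        using a by auto
    qed
  qed (use closed_Q zero_Q in \<open>auto intro: borel_closed\<close>)
qed

section \<open>Lifting a path in an orbit to a continuous time\<close>

text \<open>
  A closed graph criterion in parametrised form: over compact sets, a continuous map \<open>e\<close> may be
  transported along \<open>\<gamma> t = p s\<close> as soon as the result is single-valued, because its graph is
  then the continuous image of a compact set of pairs \<open>(t, s)\<close>.
\<close>

lemma continuous_on_transport:
  fixes \<gamma> :: "real \<Rightarrow> 'a::metric_space" and p :: "real \<Rightarrow> 'a"
    and c :: "real \<Rightarrow> 'b::euclidean_space"
  assumes "compact J" "compact K"
    and \<gamma>: "continuous_on UNIV \<gamma>" and p: "continuous_on UNIV p" and e: "continuous_on UNIV e"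
    and ex: "\<And>t. t \<in> J \<Longrightarrow> \<exists>s\<in>K. \<gamma> t = p s"
    and unique: "\<And>t s. t \<in> J \<Longrightarrow> s \<in> K \<Longrightarrow> \<gamma> t = p s \<Longrightarrow> c t = e s"
  shows "continuous_on J c"
proof (rule continuous_from_closed_graph)
  show "compact (e ` K)"
    using assms(2) e by (intro compact_continuous_image) (auto intro: continuous_on_subset)
  show "c \<in> J \<rightarrow> e ` K"
    using ex unique by blast
  have "closed {q. \<gamma> (fst q) = p (snd q)}"
    by (intro closed_Collect_eq continuous_on_compose2[OF \<gamma>] continuous_on_compose2[OF p]
        continuous_intros) auto
  then have "compact (J \<times> K \<inter> {q. \<gamma> (fst q) = p (snd q)})"
    using assms(1,2) by (intro compact_Int_closed compact_Times)
  moreover have "continuous_on UNIV (\<lambda>q :: real \<times> real. (fst q, e (snd q)))"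
    by (intro continuous_intros continuous_on_compose2[OF e]) auto
  ultimately have "compact ((\<lambda>q. (fst q, e (snd q))) ` (J \<times> K \<inter> {q. \<gamma> (fst q) = p (snd q)}))"
    by (intro compact_continuous_image) (auto intro: continuous_on_subset)
  moreover have "(\<lambda>q. (fst q, e (snd q))) ` (J \<times> K \<inter> {q. \<gamma> (fst q) = p (snd q)})
      = (\<lambda>t. (t, c t)) ` J"
  proof (intro equalityI subsetI)
    fix w assume "w \<in> (\<lambda>t. (t, c t)) ` J"
    then obtain t where t: "t \<in> J" "w = (t, c t)" by blast
    obtain s where s: "s \<in> K" "\<gamma> t = p s" using ex[OF t(1)] by blast
    have "w = (\<lambda>q. (fst q, e (snd q))) (t, s)"
      using unique[OF t(1) s] t(2) by simp
    then show "w \<in> (\<lambda>q. (fst q, e (snd q))) ` (J \<times> K \<inter> {q. \<gamma> (fst q) = p (snd q)})"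
      using t s by (intro image_eqI[where x = "(t, s)"]) auto
  qed (use unique in auto)
  ultimately show "closed ((\<lambda>t. (t, c t)) ` J)"
    by (simp add: compact_imp_closed)
qed

lemma continuous_on_UNIV_if_local:
  fixes c :: "real \<Rightarrow> 'b::topological_space"
  assumes "\<And>t. \<exists>\<epsilon>>0. continuous_on {t - \<epsilon>..t + \<epsilon>} c"
  shows "continuous_on UNIV c"
proof (rule continuous_at_imp_continuous_on, intro ballI)
  fix t
  obtain \<epsilon> where "\<epsilon> > 0" "continuous_on {t - \<epsilon>..t + \<epsilon>} c" using assms by blast
  then show "isCont c t"
    by (intro continuous_on_interior[of "{t - \<epsilon>..t + \<epsilon>}"]) auto
qed

text \<open>
  An orbit that never returns to its starting point may still accumulate on itself, so the unique
  time \<open>a t\<close> could a priori jump between far apart pieces of the orbit near a given \<open>t\<^sub>0\<close>.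
  By compactness of \<open>[1, 2]\<close>, differences of values of \<open>a\<close> near \<open>t\<^sub>0\<close> avoid this interval.
  Hence \<open>\<bar>a t - a t'\<bar> < 1\<close> is an equivalence relation on a compact interval around \<open>t\<^sub>0\<close>; its
  classes are closed and countable in number, and Sierpinski's theorem leaves only one class.
  So \<open>a\<close> is locally bounded, and the closed graph criterion applies.
\<close>

lemma orbit_time_locally_bounded:
  fixes \<psi> :: "real \<Rightarrow> 'b::metric_space \<Rightarrow> 'b"
  assumes "compact (UNIV :: 'b set)" and cont: "continuous_flow \<psi>"
    and inj: "\<And>s. \<psi> s z = z \<Longrightarrow> s = 0"
    and \<gamma>: "continuous_on UNIV (\<gamma> :: real \<Rightarrow> 'b)" and a: "\<And>t. \<gamma> t = \<psi> (a t) z"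
  obtains \<epsilon> where "\<epsilon> > 0" and "\<And>t. t \<in> {t0 - \<epsilon>..t0 + \<epsilon>} \<Longrightarrow> \<bar>a t - a t0\<bar> < 1"
proof -
  have flow: "flow \<psi>" using cont by (simp add: continuous_flow_def)
  have a_unique: "a t = s" if "\<gamma> t = \<psi> s z" for t s
    using flow_cancel[OF flow, of "a t" z s z] inj[of "a t - s"] that a[of t] by simp
  have move: "\<psi> (a t - a t') (\<gamma> t') = \<gamma> t" for t t'
    using flow by (simp add: a flow_add)
  obtain \<epsilon> where \<epsilon>: "\<epsilon> > 0"
    "\<And>t t'. t \<in> {t0 - \<epsilon>..t0 + \<epsilon>} \<Longrightarrow> t' \<in> {t0 - \<epsilon>..t0 + \<epsilon>} \<Longrightarrow> a t - a t' \<notin> {1..2}"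
  proof -
    have "continuous_on {1..2} (\<lambda>s. dist (\<psi> s (\<gamma> t0)) (\<gamma> t0))"
      by (intro continuous_intros continuous_flow_compose[OF cont])
    then obtain m where m: "m \<in> {1..2}"
      "\<And>s. s \<in> {1..2} \<Longrightarrow> dist (\<psi> m (\<gamma> t0)) (\<gamma> t0) \<le> dist (\<psi> s (\<gamma> t0)) (\<gamma> t0)"
      using continuous_attains_inf[of "{1..2::real}"] by (metis atLeastatMost_empty_iff2 compact_Icc
        one_le_numeral)
    define d where "d = dist (\<psi> m (\<gamma> t0)) (\<gamma> t0)"
    have "d > 0"
    proof (rule ccontr)
      assume "\<not> d > 0"
      then have "\<gamma> t0 = \<psi> (m + a t0) z"
        using flow by (simp add: d_def a flow_add)
      from a_unique[OF this] m(1) show False by simp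
    qed
    obtain \<rho> where \<rho>: "\<rho> > 0"
      "\<And>x y s t. \<bar>s\<bar> \<le> 2 \<Longrightarrow> \<bar>t\<bar> \<le> 2 \<Longrightarrow> \<bar>s - t\<bar> < \<rho> \<Longrightarrow> dist x y < \<rho> \<Longrightarrow>
         dist (\<psi> s x) (\<psi> t y) < d / 2"
      using flow_uniformly_continuous[OF assms(1) cont, of "d / 2" 2] \<open>d > 0\<close> by auto
    have "isCont \<gamma> t0"
      using \<gamma> by (simp add: continuous_on_eq_continuous_at)
    then obtain e where e: "e > 0" "\<And>t. dist t t0 < e \<Longrightarrow> dist (\<gamma> t) (\<gamma> t0) < min \<rho> (d / 2)"
      unfolding continuous_at_eps_delta using \<rho>(1) \<open>d > 0\<close> by (metis half_gt_zero min_less_iff_conj)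
    show ?thesis
    proof (rule that)
      show "e / 2 > 0" using e(1) by simp
      fix t t' assume tt: "t \<in> {t0 - e / 2..t0 + e / 2}" "t' \<in> {t0 - e / 2..t0 + e / 2}"
      have near: "dist (\<gamma> t) (\<gamma> t0) < d / 2" "dist (\<gamma> t') (\<gamma> t0) < \<rho>"
        using e(2)[of t] e(2)[of t'] tt e(1) by (auto simp: dist_real_def abs_if)
      show "a t - a t' \<notin> {1..2}"
      proof
        assume s: "a t - a t' \<in> {1..2}"
        have "dist (\<psi> (a t - a t') (\<gamma> t')) (\<psi> (a t - a t') (\<gamma> t0)) < d / 2"
          using s near(2) \<rho>(1) by (intro \<rho>(2)) auto
        then have "dist (\<gamma> t) (\<psi> (a t - a t') (\<gamma> t0)) < d / 2"
          by (simp add: move)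
        then have "dist (\<psi> (a t - a t') (\<gamma> t0)) (\<gamma> t0) < d"
          using near(1) by (metis dist_commute dist_triangle_half_l)
        then show False
          using m(2)[OF s] by (simp add: d_def)
      qed
    qed
  qed
  define N where "N = {t0 - \<epsilon>..t0 + \<epsilon>}"
  have gap: "\<bar>a t - a t'\<bar> < 1 \<or> \<bar>a t - a t'\<bar> > 2" if "t \<in> N" "t' \<in> N" for t t'
    using \<epsilon>(2)[of t t'] \<epsilon>(2)[of t' t] that by (auto simp: N_def)
  have trans: "\<bar>a t - a t''\<bar> < 1"
    if "t \<in> N" "t'' \<in> N" "\<bar>a t - a t'\<bar> < 1" "\<bar>a t' - a t''\<bar> < 1" for t t' t''
    using gap[OF that(1,2)] that(3,4) by linarith
  define C where "C t = {t'\<in>N. \<bar>a t - a t'\<bar> < 1}" for t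
  have C_eq: "C t = C t'" if "t \<in> N" "t' \<in> N" "\<bar>a t - a t'\<bar> < 1" for t t'
    using that trans unfolding C_def by (smt (verit) Collect_cong)
  have refl: "t \<in> C t" if "t \<in> N" for t
    using that by (simp add: C_def)
  have "C ` N = {N}"
    unfolding N_def
  proof (rule real_Sierpinski_lemma)
    show "t0 - \<epsilon> \<le> t0 + \<epsilon>" using \<epsilon>(1) by simp
    \<comment> \<open>A class is determined by the integer part of any of its times.\<close>
    have "C ` N \<subseteq> range (\<lambda>k. \<Union>(C ` {t\<in>N. \<lfloor>a t\<rfloor> = k}))"
    proof
      fix S assume "S \<in> C ` N"
      then obtain t where t: "t \<in> N" "S = C t" by blast
      have "C t' = C t" if "t' \<in> N" "\<lfloor>a t'\<rfloor> = \<lfloor>a t\<rfloor>" for t'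
      proof (rule C_eq)
        show "\<bar>a t' - a t\<bar> < 1"
          using that(2) floor_correct[of "a t'"] floor_correct[of "a t"] by linarith
      qed (use that t in auto)
      then have "\<Union>(C ` {t'\<in>N. \<lfloor>a t'\<rfloor> = \<lfloor>a t\<rfloor>}) = (\<Union>t'\<in>{t'\<in>N. \<lfloor>a t'\<rfloor> = \<lfloor>a t\<rfloor>}. C t)"
        by (intro SUP_cong) auto
      also have "\<dots> = S"
        using t by auto
      finally have "\<Union>(C ` {t'\<in>N. \<lfloor>a t'\<rfloor> = \<lfloor>a t\<rfloor>}) = S" .
      then show "S \<in> range (\<lambda>k. \<Union>(C ` {t\<in>N. \<lfloor>a t\<rfloor> = k}))" by blast
    qed
    then show "countable (C ` {t0 - \<epsilon>..t0 + \<epsilon>})"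
      unfolding N_def[symmetric] by (rule countable_subset) simp
    show "disjoint (C ` {t0 - \<epsilon>..t0 + \<epsilon>})"
      unfolding N_def[symmetric]
    proof (rule pairwiseI)
      fix S S' assume "S \<in> C ` N" "S' \<in> C ` N" "S \<noteq> S'"
      then obtain t t' where t: "t \<in> N" "S = C t" "t' \<in> N" "S' = C t'" by blast
      show "disjnt S S'"
      proof (rule ccontr)
        assume "\<not> disjnt S S'"
        then obtain u where "u \<in> N" "\<bar>a t - a u\<bar> < 1" "\<bar>a t' - a u\<bar> < 1"
          unfolding t disjnt_iff C_def by blast
        then have "C t = C u" "C t' = C u"
          using t C_eq by blast+
        then show False using t \<open>S \<noteq> S'\<close> by simp
      qed
    qed
    show "\<Union>(C ` {t0 - \<epsilon>..t0 + \<epsilon>}) = {t0 - \<epsilon>..t0 + \<epsilon>}"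
      unfolding N_def[symmetric] using refl by (auto simp: C_def)
    fix S assume "S \<in> C ` {t0 - \<epsilon>..t0 + \<epsilon>}"
    then obtain t where t: "t \<in> N" "S = C t" unfolding N_def by blast
    \<comment> \<open>Because of the gap, the strict inequality may be relaxed to a closed condition.\<close>
    have "S = N \<inter> \<gamma> -` ((\<lambda>s. \<psi> s z) ` {a t - 1..a t + 1})"
    proof (intro equalityI subsetI)
      fix u assume "u \<in> S"
      then have "u \<in> N" "a u \<in> {a t - 1..a t + 1}"
        by (auto simp: t C_def)
      then show "u \<in> N \<inter> \<gamma> -` ((\<lambda>s. \<psi> s z) ` {a t - 1..a t + 1})"
        using a[of u] by blast
    next
      fix u assume "u \<in> N \<inter> \<gamma> -` ((\<lambda>s. \<psi> s z) ` {a t - 1..a t + 1})"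
      then obtain s where s: "u \<in> N" "\<gamma> u = \<psi> s z" "s \<in> {a t - 1..a t + 1}" by blast
      then have "\<bar>a t - a u\<bar> \<le> 1"
        using a_unique[OF s(2)] by auto
      then show "u \<in> S"
        using gap[OF t(1) s(1)] s(1) t(2) by (auto simp: C_def)
    qed
    moreover have "closed ((\<lambda>s. \<psi> s z) ` {a t - 1..a t + 1})"
      by (intro compact_imp_closed compact_continuous_image continuous_flow_compose[OF cont]
          continuous_intros) auto
    ultimately have "closed S"
      using closed_vimage[OF _ \<gamma>] by (auto simp: N_def)
    then show "closed S \<and> S \<noteq> {}"
      using t refl by blast
  qed
  moreover have "t0 \<in> N" using \<epsilon>(1) by (simp add: N_def)
  ultimately have "C t0 = N" by blast
  then have "\<bar>a t - a t0\<bar> < 1" if "t \<in> N" for t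
    using that unfolding C_def by (smt (verit) mem_Collect_eq)
  then show ?thesis
    using that \<epsilon>(1) unfolding N_def by blast
qed

lemma lift_path_nonperiodic_orbit:
  fixes \<psi> :: "real \<Rightarrow> 'b::metric_space \<Rightarrow> 'b"
  assumes "compact (UNIV :: 'b set)" and cont: "continuous_flow \<psi>"
    and inj: "\<And>s. \<psi> s z = z \<Longrightarrow> s = 0"
    and \<gamma>: "continuous_on UNIV (\<gamma> :: real \<Rightarrow> 'b)" and a: "\<And>t. \<gamma> t = \<psi> (a t) z"
  shows "continuous_on UNIV a"
proof (rule continuous_on_UNIV_if_local)
  fix t0
  have flow: "flow \<psi>" using cont by (simp add: continuous_flow_def)
  obtain \<epsilon> where \<epsilon>: "\<epsilon> > 0" "\<And>t. t \<in> {t0 - \<epsilon>..t0 + \<epsilon>} \<Longrightarrow> \<bar>a t - a t0\<bar> < 1"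
    using orbit_time_locally_bounded[OF assms] by metis
  have "continuous_on {t0 - \<epsilon>..t0 + \<epsilon>} a"
  proof (rule continuous_on_transport[where \<gamma> = \<gamma> and p = "\<lambda>s. \<psi> s z" and K = "{a t0 - 1..a t0 + 1}" and e = "\<lambda>s. s"])
    show "continuous_on UNIV (\<lambda>s. \<psi> s z)"
      by (intro continuous_flow_compose[OF cont] continuous_intros)
    show "\<exists>s\<in>{a t0 - 1..a t0 + 1}. \<gamma> t = \<psi> s z" if "t \<in> {t0 - \<epsilon>..t0 + \<epsilon>}" for t
      using \<epsilon>(2)[OF that] a[of t] by (intro bexI[of _ "a t"]) auto
    show "a t = s" if "\<gamma> t = \<psi> s z" for t s
      using flow_cancel[OF flow, of "a t" z s z] inj[of "a t - s"] that a[of t] by simp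
  qed (use \<gamma> in \<open>auto intro: continuous_intros\<close>)
  then show "\<exists>\<epsilon>>0. continuous_on {t0 - \<epsilon>..t0 + \<epsilon>} a"
    using \<epsilon>(1) by blast
qed

text \<open>
  A periodic orbit is a circle, with angle \<open>2 \<pi> s / T\<close> at \<open>\<psi> s z\<close>. The angle of the path, as a
  point of the unit circle, is continuous, and its continuous logarithm is the lift.
\<close>

lemma lift_path_periodic_orbit:
  fixes \<psi> :: "real \<Rightarrow> 'b::metric_space \<Rightarrow> 'b"
  assumes cont: "continuous_flow \<psi>"
    and T: "T > 0" "\<And>s. \<psi> s z = z \<longleftrightarrow> (\<exists>k::int. s = of_int k * T)"
    and \<gamma>: "continuous_on UNIV (\<gamma> :: real \<Rightarrow> 'b)" and a: "\<And>t. \<gamma> t = \<psi> (a t) z"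
  obtains b where "continuous_on UNIV b" and "\<And>t. \<gamma> t = \<psi> (b t) z"
proof -
  have flow: "flow \<psi>" using cont by (simp add: continuous_flow_def)
  have per: "\<psi> T z = z" using T(2)[of T] by (metis mult_1 of_int_1)
  define E where "E s = exp (\<i> * of_real (2 * pi * s / T))" for s
  have contE: "continuous_on UNIV E"
    unfolding E_def by (intro continuous_intros) (use T(1) in auto)
  have E_eq: "E (a t) = E s" if "\<gamma> t = \<psi> s z" for t s
  proof -
    have "\<psi> (a t - s) z = z"
      using that a[of t] by (intro flow_cancel[OF flow]) simp
    then obtain k :: int where "a t - s = of_int k * T" using T(2) by blast
    then have k: "a t = s + of_int k * T" by simp
    show ?thesis
      unfolding E_def exp_eq k using T(1)
      by (intro exI[of _ k]) (simp add: field_simps)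
  qed
  have "continuous_on UNIV (\<lambda>t. E (a t))"
  proof (rule continuous_on_UNIV_if_local, intro exI[of _ 1] conjI)
    fix t0
    show "continuous_on {t0 - 1..t0 + 1} (\<lambda>t. E (a t))"
    proof (rule continuous_on_transport[where \<gamma> = \<gamma> and p = "\<lambda>s. \<psi> s z" and K = "{0..T}" and e = E])
      show "continuous_on UNIV (\<lambda>s. \<psi> s z)"
        by (intro continuous_flow_compose[OF cont] continuous_intros)
      fix t
      define k where "k = \<lfloor>a t / T\<rfloor>"
      have "of_int k \<le> a t / T" "a t / T \<le> of_int k + 1"
        unfolding k_def by linarith+
      then have "a t - of_int k * T \<in> {0..T}"
        using T(1) by (simp add: pos_le_divide_eq pos_divide_le_eq algebra_simps)
      moreover have "\<gamma> t = \<psi> (a t - of_int k * T) z"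
        using flow_period_shift[OF flow per, of "a t - of_int k * T" k] a[of t] by simp
      ultimately show "\<exists>s\<in>{0..T}. \<gamma> t = \<psi> s z" by blast
    qed (use \<gamma> contE E_eq in auto)
  qed simp
  moreover have "contractible (UNIV :: real set)"
    by (simp add: convex_imp_contractible)
  moreover have "E (a t) \<noteq> 0" for t
    by (simp add: E_def)
  ultimately obtain g where g: "continuous_on UNIV g" "\<And>t. E (a t) = exp (g t)"
    by (rule continuous_logarithm_on_contractible) simp_all
  show ?thesis
  proof
    show "continuous_on UNIV (\<lambda>t. T * Im (g t) / (2 * pi))"
      using g(1) by (intro continuous_intros) auto
    fix t
    obtain k :: int where "g t = \<i> * of_real (2 * pi * a t / T) + (of_int (2 * k) * pi) * \<i>"
      using g(2)[of t] unfolding E_def by (metis exp_eq)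
    then have "Im (g t) = 2 * pi * a t / T + 2 * of_int k * pi" by simp
    then have "T * Im (g t) / (2 * pi) = a t + of_int k * T"
      using T(1) by (simp add: field_simps)
    then show "\<gamma> t = \<psi> (T * Im (g t) / (2 * pi)) z"
      using flow_period_shift[OF flow per] a[of t] by simp
  qed
qed

text \<open>
  The return times of a point form a closed subgroup of the real line, so it is everything, or
  trivial, or generated by one positive number.
\<close>

lemma return_times_cases:
  fixes \<psi> :: "real \<Rightarrow> 'b::metric_space \<Rightarrow> 'b"
  assumes cont: "continuous_flow \<psi>"
  obtains (singular) "\<And>s. \<psi> s z = z"
    | (nonperiodic) "\<And>s. \<psi> s z = z \<Longrightarrow> s = 0"
    | (periodic) T where "T > 0" and "\<And>s. \<psi> s z = z \<longleftrightarrow> (\<exists>k::int. s = of_int k * T)"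
proof -
  have flow: "flow \<psi>" using cont by (simp add: continuous_flow_def)
  define P where "P = {s. s > 0 \<and> \<psi> s z = z}"
  have rem: "\<exists>r. 0 \<le> r \<and> r < p \<and> \<psi> r z = \<psi> s z \<and> (\<exists>k::int. s = r + of_int k * p)" if "p \<in> P" for p s
  proof -
    define k where "k = \<lfloor>s / p\<rfloor>"
    have p: "p > 0" "\<psi> p z = z" using that by (auto simp: P_def)
    have "of_int k \<le> s / p" "s / p < of_int k + 1"
      unfolding k_def by linarith+
    then have "0 \<le> s - of_int k * p" "s - of_int k * p < p"
      using p(1) by (simp_all add: pos_le_divide_eq pos_divide_less_eq algebra_simps)
    moreover have "\<psi> (s - of_int k * p) z = \<psi> s z"
      using flow_period_shift[OF flow p(2), of "s - of_int k * p" k] by simp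
    ultimately show ?thesis
      by (intro exI[of _ "s - of_int k * p"]) auto
  qed
  have contz: "continuous_on UNIV (\<lambda>s. \<psi> s z)"
    by (intro continuous_flow_compose[OF cont] continuous_intros)
  show ?thesis
  proof (cases "P = {}")
    case True
    have "s = 0" if "\<psi> s z = z" for s
    proof (rule ccontr)
      assume "s \<noteq> 0"
      have "\<psi> (- s) z = z"
        using flow_cancel[OF flow, of 0 z s z] that flow by (simp add: flow_0)
      then have "s \<in> P \<or> - s \<in> P"
        using that \<open>s \<noteq> 0\<close> by (auto simp: P_def)
      then show False using True by blast
    qed
    then show ?thesis by (rule nonperiodic)
  next
    case False
    define T where "T = Inf P"
    have bdd: "bdd_below P" by (rule bdd_belowI[of _ 0]) (auto simp: P_def)
    have lower: "T \<le> s" if "s \<in> P" for s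
      unfolding T_def using bdd that by (rule cInf_lower[rotated])
    have "T \<ge> 0"
      unfolding T_def using False by (intro cInf_greatest) (auto simp: P_def)
    have close: "\<exists>p\<in>P. p < T + e" if "e > 0" for e
      using cInf_lessD[OF False, of "T + e"] that by (auto simp: T_def)
    show ?thesis
    proof (cases "T = 0")
      case True
      have "\<psi> s z = z" for s
      proof (rule ccontr)
        assume "\<psi> s z \<noteq> z"
        have "isCont (\<lambda>s. \<psi> s z) 0"
          using contz by (simp add: continuous_on_eq_continuous_at)
        then obtain d where d: "d > 0"
          "\<And>r. dist r 0 < d \<Longrightarrow> dist (\<psi> r z) (\<psi> 0 z) < dist (\<psi> s z) z"
          unfolding continuous_at_eps_delta using \<open>\<psi> s z \<noteq> z\<close> by (metis zero_less_dist_iff)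
        obtain p where p: "p \<in> P" "p < d" using close[OF d(1)] True by auto
        obtain r where r: "0 \<le> r" "r < p" "\<psi> r z = \<psi> s z" using rem[OF p(1)] by blast
        show False
          using d(2)[of r] r p(2) flow by (simp add: flow_0)
      qed
      then show ?thesis by (rule singular)
    next
      case False
      with \<open>T \<ge> 0\<close> have "T > 0" by simp
      have "closed {s. \<psi> s z = z}"
        using contz by (intro closed_Collect_eq continuous_intros)
      moreover have "T \<in> closure {s. \<psi> s z = z}"
        unfolding closure_approachable
      proof (intro allI impI)
        fix e :: real assume "e > 0"
        then obtain p where p: "p \<in> P" "p < T + e" using close by blast
        then show "\<exists>y\<in>{s. \<psi> s z = z}. dist y T < e"
          using lower[OF p(1)] by (intro bexI[of _ p]) (auto simp: P_def dist_real_def)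
      qed
      ultimately have T: "\<psi> T z = z" by (simp add: closure_closed)
      then have "T \<in> P" using \<open>T > 0\<close> by (simp add: P_def)
      have "\<psi> s z = z \<longleftrightarrow> (\<exists>k::int. s = of_int k * T)" for s
      proof
        assume s: "\<psi> s z = z"
        obtain r k where r: "0 \<le> r" "r < T" "\<psi> r z = \<psi> s z" "s = r + of_int (k::int) * T"
          using rem[OF \<open>T \<in> P\<close>, of s] by blast
        have "r = 0"
          using lower[of r] r s by (cases "r = 0") (auto simp: P_def)
        then show "\<exists>k::int. s = of_int k * T" using r(4) by auto
      qed (use flow_period_multiple[OF flow T] in auto)
      with \<open>T > 0\<close> show ?thesis by (rule periodic)
    qed
  qed
qed

lemma lift_path_in_orbit:
  fixes \<psi> :: "real \<Rightarrow> 'b::metric_space \<Rightarrow> 'b"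
  assumes "compact (UNIV :: 'b set)" and cont: "continuous_flow \<psi>"
    and \<gamma>: "continuous_on UNIV (\<gamma> :: real \<Rightarrow> 'b)" and orbit: "\<And>t. \<gamma> t \<in> flow_orbit \<psi> (\<gamma> 0)"
  obtains b where "b \<in> time_changes" and "\<And>t. \<gamma> t = \<psi> (b t) (\<gamma> 0)"
proof -
  have flow: "flow \<psi>" using cont by (simp add: continuous_flow_def)
  have "\<exists>s. \<gamma> t = \<psi> s (\<gamma> 0)" for t
    using orbit[of t] by (auto simp: flow_seg_def)
  then obtain a where a: "\<And>t. \<gamma> t = \<psi> (a t) (\<gamma> 0)" by metis
  have "\<exists>b. continuous_on UNIV b \<and> (\<forall>t. \<gamma> t = \<psi> (b t) (\<gamma> 0))"
  proof (rule return_times_cases[OF cont, of "\<gamma> 0"])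
    assume "\<And>s. \<psi> s (\<gamma> 0) = \<gamma> 0"
    then have zero: "\<gamma> t = \<psi> 0 (\<gamma> 0)" for t
      using a by metis
    show ?thesis
      by (intro exI[of _ "\<lambda>_. 0"] conjI allI continuous_on_const zero)
  next
    assume nonperiodic: "\<And>s. \<psi> s (\<gamma> 0) = \<gamma> 0 \<Longrightarrow> s = 0"
    from lift_path_nonperiodic_orbit[OF assms(1) cont nonperiodic \<gamma> a] a show ?thesis by blast
  next
    fix T :: real
    assume periodic: "T > 0" "\<And>s. \<psi> s (\<gamma> 0) = \<gamma> 0 \<longleftrightarrow> (\<exists>k::int. s = of_int k * T)"
    from lift_path_periodic_orbit[OF cont periodic \<gamma> a] show ?thesis by metis
  qed
  then obtain b where b: "continuous_on UNIV b" "\<And>t. \<gamma> t = \<psi> (b t) (\<gamma> 0)" by blast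
  \<comment> \<open>Around a periodic orbit \<open>b 0\<close> may be a nonzero multiple of the period.\<close>
  have "\<psi> (- b 0) (\<gamma> 0) = \<gamma> 0"
    using flow_cancel[OF flow, of 0 "\<gamma> 0" "b 0" "\<gamma> 0"] b(2)[of 0] flow by (simp add: flow_0)
  then have "\<psi> (b t - b 0) (\<gamma> 0) = \<gamma> t" for t
    using flow_add[OF flow, of "b t" "- b 0" "\<gamma> 0"] b(2)[of t] by simp
  moreover have "(\<lambda>t. b t - b 0) \<in> time_changes"
    using b(1) by (auto simp: time_changes_def intro!: continuous_intros)
  ultimately show ?thesis
    using that by metis
qed

section \<open>Invariance under equivalence\<close>

lemma flow_equivalence_orbit:
  assumes "flow \<phi>" and "flow \<psi>" and "flow_equivalence \<phi> \<psi> f"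
  shows "f ` flow_orbit \<phi> x = flow_orbit \<psi> (f x)"
proof -
  obtain y where y: "f ` flow_orbit \<phi> x = flow_orbit \<psi> y"
    using assms(3) unfolding flow_equivalence_def by blast
  have "x \<in> flow_orbit \<phi> x"
    using flow_0[OF assms(1), of x, symmetric] unfolding flow_seg_def by blast
  then have "f x \<in> flow_orbit \<psi> y" using y by blast
  then show ?thesis
    using orbit_eqI[OF assms(2)] y by metis
qed

lemma flow_equivalence_inverse:
  assumes "flow \<phi>" and "flow \<psi>" and "flow_equivalence \<phi> \<psi> f" and "homeomorphism UNIV UNIV f g"
  shows "flow_equivalence \<psi> \<phi> g"
proof -
  have gf: "g (f x) = x" and fg: "f (g y) = y" for x y
    using assms(4) by (simp_all add: homeomorphism_def)
  have "g ` flow_orbit \<psi> y = flow_orbit \<phi> (g y)" for y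
  proof -
    have "flow_orbit \<psi> y = f ` flow_orbit \<phi> (g y)"
      using flow_equivalence_orbit[OF assms(1-3), of "g y"] by (simp add: fg)
    then show ?thesis by (simp add: image_image gf)
  qed
  moreover have "homeomorphism UNIV UNIV g f"
    using assms(4) by (rule homeomorphism_symD)
  ultimately show ?thesis
    unfolding flow_equivalence_def by blast
qed

text \<open>
  The image under \<open>f\<close> of the motion of \<open>x\<close> is a continuous path in a single orbit of \<open>\<psi>\<close>, so it
  lifts to a continuous time.
\<close>

lemma flow_equivalence_time:
  fixes \<phi> :: "real \<Rightarrow> 'a::metric_space \<Rightarrow> 'a" and \<psi> :: "real \<Rightarrow> 'b::metric_space \<Rightarrow> 'b"
  assumes "compact (UNIV :: 'b set)" and "continuous_flow \<phi>" and "continuous_flow \<psi>"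
    and "flow_equivalence \<phi> \<psi> f"
  obtains b where "b \<in> time_changes" and "\<And>t. f (\<phi> t x) = \<psi> (b t) (f x)"
proof -
  have flow: "flow \<phi>" "flow \<psi>" using assms(2,3) by (auto simp: continuous_flow_def)
  have 0: "f (\<phi> 0 x) = f x" using flow(1) by (simp add: flow_0)
  have "continuous_on UNIV f"
    using assms(4) by (auto simp: flow_equivalence_def homeomorphism_def)
  then have cont: "continuous_on UNIV (\<lambda>t. f (\<phi> t x))"
    by (rule continuous_on_compose2)
      (auto intro!: continuous_flow_compose[OF assms(2)] continuous_intros)
  have "f (\<phi> t x) \<in> flow_orbit \<psi> (f (\<phi> 0 x))" for t
  proof -
    have "\<phi> t x \<in> flow_orbit \<phi> x"
      by (auto simp: flow_seg_def)
    then have "f (\<phi> t x) \<in> f ` flow_orbit \<phi> x"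
      by (rule imageI)
    then show ?thesis
      by (simp only: flow_equivalence_orbit[OF flow assms(4)] 0)
  qed
  then obtain b where "b \<in> time_changes" "\<And>t. f (\<phi> t x) = \<psi> (b t) (f (\<phi> 0 x))"
    by (rule lift_path_in_orbit[OF assms(1,3) cont]) blast
  then show ?thesis
    using that by (simp only: 0)
qed

text \<open>
  A time change \<open>h\<close> witnessing shadowing for \<open>\<psi>\<close> is carried over to \<open>\<phi>\<close> as \<open>b \<circ> h \<circ> c\<close>, where
  \<open>c\<close> moves the \<open>\<phi>\<close>-time of \<open>x\<close> to the \<open>\<psi>\<close>-time of \<open>f x\<close>, and \<open>b\<close> the \<open>\<psi>\<close>-time of \<open>y\<close> to the
  \<open>\<phi>\<close>-time of \<open>g y\<close>.
\<close>

lemma flow_equivalence_Gamma_set: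
  fixes \<phi> :: "real \<Rightarrow> 'a::metric_space \<Rightarrow> 'a" and \<psi> :: "real \<Rightarrow> 'b::metric_space \<Rightarrow> 'b"
  assumes "compact (UNIV :: 'a set)" and "compact (UNIV :: 'b set)"
    and \<phi>: "continuous_flow \<phi>" and \<psi>: "continuous_flow \<psi>"
    and f: "flow_equivalence \<phi> \<psi> f" and fg: "homeomorphism UNIV UNIV f g" and "\<delta> > 0"
  obtains \<delta>' where "\<delta>' > 0"
    and "\<And>x y. y \<in> Gamma_set \<psi> \<delta>' (f x) \<Longrightarrow> g y \<in> Gamma_set \<phi> \<delta> x"
proof -
  have flow: "flow \<phi>" "flow \<psi>" using \<phi> \<psi> by (auto simp: continuous_flow_def)
  have g: "flow_equivalence \<psi> \<phi> g"
    using flow_equivalence_inverse[OF flow f fg] .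
  have gf: "g (f x) = x" for x using fg by (simp add: homeomorphism_def)
  have "uniformly_continuous_on UNIV g"
    using fg assms(2) by (intro compact_uniformly_continuous) (auto simp: homeomorphism_def)
  then obtain e where e: "e > 0" "\<And>u v. dist u v < e \<Longrightarrow> dist (g u) (g v) < \<delta>"
    unfolding uniformly_continuous_on_def using \<open>\<delta> > 0\<close> by (metis UNIV_I)
  show ?thesis
  proof
    show "e / 2 > 0" using e(1) by simp
    fix x y assume "y \<in> Gamma_set \<psi> (e / 2) (f x)"
    then obtain h where h: "h \<in> time_changes" "\<And>t. dist (\<psi> t (f x)) (\<psi> (h t) y) \<le> e / 2"
      unfolding mem_Gamma_set_iff[OF flow(2)] by blast
    obtain b where b: "b \<in> time_changes" "\<And>t. g (\<psi> t y) = \<phi> (b t) (g y)"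
      using flow_equivalence_time[OF assms(1) \<psi> \<phi> g] by blast
    obtain c where c: "c \<in> time_changes" "\<And>t. f (\<phi> t x) = \<psi> (c t) (f x)"
      using flow_equivalence_time[OF assms(2) \<phi> \<psi> f] by blast
    have "(\<lambda>t. b (h (c t))) \<in> time_changes"
    proof -
      have "continuous_on UNIV (\<lambda>t. h (c t))"
        using h(1) c(1) by (auto simp: time_changes_def intro: continuous_on_compose2)
      then have "continuous_on UNIV (\<lambda>t. b (h (c t)))"
        using b(1) continuous_on_compose2[of UNIV b UNIV "\<lambda>t. h (c t)"]
        by (simp add: time_changes_def)
      then show ?thesis
        using b(1) h(1) c(1) by (simp add: time_changes_def)
    qed
    moreover have "dist (\<phi> t x) (\<phi> (b (h (c t))) (g y)) \<le> \<delta>" for t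
    proof -
      have "dist (f (\<phi> t x)) (\<psi> (h (c t)) y) < e"
        using h(2)[of "c t"] e(1) by (simp add: c(2))
      from e(2)[OF this] show ?thesis
        by (simp add: gf b(2))
    qed
    ultimately show "g y \<in> Gamma_set \<phi> \<delta> x"
      unfolding mem_Gamma_set_iff[OF flow(1)] by (intro bexI) auto
  qed
qed

lemma expansive_measure_distr:
  fixes \<phi> :: "real \<Rightarrow> 'a::metric_space \<Rightarrow> 'a" and \<psi> :: "real \<Rightarrow> 'b::metric_space \<Rightarrow> 'b"
  assumes "compact (UNIV :: 'a set)" and "compact (UNIV :: 'b set)"
    and \<phi>: "continuous_flow \<phi>" and \<psi>: "continuous_flow \<psi>"
    and f: "flow_equivalence \<phi> \<psi> f" and fg: "homeomorphism UNIV UNIV f g"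
    and \<mu>: "borel_measure \<mu>" and "expansive_measure \<phi> \<mu>"
  shows "expansive_measure \<psi> (distr \<mu> borel f)"
proof -
  have sets: "sets \<mu> = sets borel" using \<mu> by (simp add: borel_measure_def)
  then have space: "space \<mu> = UNIV" by (metis sets_eq_imp_space_eq space_borel)
  have gf: "g (f x) = x" and fg': "f (g y) = y" for x y
    using fg by (simp_all add: homeomorphism_def)
  have "f \<in> measurable borel borel"
    using fg by (intro borel_measurable_continuous_onI) (simp add: homeomorphism_def)
  then have meas: "f \<in> measurable \<mu> borel"
    using measurable_cong_sets[OF sets refl] by blast
  obtain \<delta> where \<delta>: "\<delta> > 0" "\<And>x. measure_zero \<mu> (Gamma_set \<phi> \<delta> x)"
    using assms(8) by (auto simp: expansive_measure_def)
  obtain \<delta>' where \<delta>': "\<delta>' > 0"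
    "\<And>x y. y \<in> Gamma_set \<psi> \<delta>' (f x) \<Longrightarrow> g y \<in> Gamma_set \<phi> \<delta> x"
    using flow_equivalence_Gamma_set[OF assms(1-6) \<delta>(1)] by metis
  have "emeasure (distr \<mu> borel f) A = 0" if A: "A \<in> sets borel" "A \<subseteq> Gamma_set \<psi> \<delta>' y" for A y
  proof -
    have "f -` A \<subseteq> Gamma_set \<phi> \<delta> (g y)"
      using \<delta>'(2)[of _ "g y"] A(2) by (metis gf fg' subsetD subsetI vimageD)
    moreover have "f -` A \<in> sets borel"
      using measurable_sets[OF meas A(1)] by (simp add: space sets)
    ultimately have "emeasure \<mu> (f -` A) = 0"
      using \<delta>(2) unfolding measure_zero_def by blast
    then show ?thesis
      using A(1) meas by (simp add: emeasure_distr space)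
  qed
  then show ?thesis
    using \<delta>'(1) unfolding expansive_measure_def measure_zero_def by blast
qed

lemma expansive_measure_distr_iff:
  fixes \<phi> :: "real \<Rightarrow> 'a::metric_space \<Rightarrow> 'a" and \<psi> :: "real \<Rightarrow> 'b::metric_space \<Rightarrow> 'b"
  assumes "compact (UNIV :: 'a set)" and \<phi>: "continuous_flow \<phi>" and \<psi>: "continuous_flow \<psi>"
    and f: "flow_equivalence \<phi> \<psi> f" and \<mu>: "borel_measure \<mu>"
  shows "expansive_measure \<phi> \<mu> \<longleftrightarrow> expansive_measure \<psi> (distr \<mu> borel f)"
proof -
  have flow: "flow \<phi>" "flow \<psi>" using \<phi> \<psi> by (auto simp: continuous_flow_def)
  obtain g where fg: "homeomorphism UNIV UNIV f g"
    using f by (auto simp: flow_equivalence_def)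
  have "compact (f ` UNIV)"
    using fg assms(1) by (intro compact_continuous_image) (auto simp: homeomorphism_def)
  then have compact: "compact (UNIV :: 'b set)"
    using fg by (simp add: homeomorphism_def)
  have sets: "sets \<mu> = sets borel" using \<mu> by (simp add: borel_measure_def)
  have "f \<in> measurable borel borel" "g \<in> measurable borel borel"
    using fg by (auto intro!: borel_measurable_continuous_onI simp: homeomorphism_def)
  then have "distr (distr \<mu> borel f) borel g = distr \<mu> borel (g \<circ> f)"
    using measurable_cong_sets[OF sets refl] by (intro distr_distr) auto
  also have "g \<circ> f = (\<lambda>x. x)"
    using fg by (auto simp: homeomorphism_def)
  also have "distr \<mu> borel (\<lambda>x. x) = \<mu>"
    using sets by (intro distr_id2) simp
  finally have distr_back: "distr (distr \<mu> borel f) borel g = \<mu>" .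
  show ?thesis
  proof
    assume "expansive_measure \<phi> \<mu>"
    then show "expansive_measure \<psi> (distr \<mu> borel f)"
      by (rule expansive_measure_distr[OF assms(1) compact \<phi> \<psi> f fg \<mu>])
  next
    assume "expansive_measure \<psi> (distr \<mu> borel f)"
    then have "expansive_measure \<phi> (distr (distr \<mu> borel f) borel g)"
      by (intro expansive_measure_distr[OF compact assms(1) \<psi> \<phi>
            flow_equivalence_inverse[OF flow f fg] homeomorphism_symD[OF fg]])
        (simp_all add: borel_measure_def)
    then show "expansive_measure \<phi> \<mu>" by (simp add: distr_back)
  qed
qed

section \<open>Expansive flows\<close>

text \<open>
  Expansivity at any fixed scale already confines \<^term>\<open>Gamma_set \<phi> \<delta> x\<close> to the orbit of \<open>x\<close>.
\<close>

lemma expansive_flow_imp_expansive_measure: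
  assumes "continuous_flow \<phi>" and "expansive_flow \<phi>" and "vanishes_along_orbits \<phi> \<nu>"
  shows "expansive_measure \<phi> \<nu>"
proof -
  have flow: "flow \<phi>" using assms(1) by (simp add: continuous_flow_def)
  obtain \<delta> where \<delta>: "\<delta> > 0"
    "\<And>x y. \<exists>h\<in>time_changes. \<forall>t. dist (\<phi> t x) (\<phi> (h t) y) \<le> \<delta> \<Longrightarrow> y \<in> flow_seg \<phi> {-1<..<1} x"
    using assms(2) unfolding expansive_flow_def by (metis zero_less_one)
  have "Gamma_set \<phi> \<delta> x \<subseteq> flow_orbit \<phi> x" for x
  proof
    fix y assume "y \<in> Gamma_set \<phi> \<delta> x"
    then have "y \<in> flow_seg \<phi> {-1<..<1} x"
      unfolding mem_Gamma_set_iff[OF flow] by (rule \<delta>(2))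
    then show "y \<in> flow_orbit \<phi> x"
      by (auto simp: flow_seg_def)
  qed
  then have "measure_zero \<nu> (Gamma_set \<phi> \<delta> x)" for x
    using assms(3) measure_zero_mono unfolding vanishes_along_orbits_def by blast
  then show ?thesis
    using \<delta>(1) unfolding expansive_measure_def by blast
qed

theorem theorem2p2:
  fixes \<phi> :: "real \<Rightarrow> 'a::metric_space \<Rightarrow> 'a"
    and \<mu> :: "'a measure"
  assumes "compact (UNIV :: 'a set)"
    and "continuous_flow \<phi>"
    and "borel_measure \<mu>"
  shows "(expansive_measure \<phi> \<mu> \<longrightarrow> supp \<mu> \<inter> Sing \<phi> = {})
    \<and> (expansive_measure \<phi> \<mu> \<longrightarrow> aperiodic_wrt \<phi> \<mu>)
    \<and> (\<forall>(\<psi> :: real \<Rightarrow> 'b::metric_space \<Rightarrow> 'b) f.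
          continuous_flow \<psi> \<and> flow_equivalence \<phi> \<psi> f \<longrightarrow>
          (expansive_measure \<phi> \<mu> \<longleftrightarrow> expansive_measure \<psi> (distr \<mu> borel f)))
    \<and> (expansive_measure \<phi> \<mu> \<longrightarrow> vanishes_along_orbits \<phi> \<mu>)
    \<and> (expansive_flow \<phi> \<longrightarrow>
          (\<forall>\<nu> :: 'a measure. borel_measure \<nu> \<and> vanishes_along_orbits \<phi> \<nu> \<longrightarrow>
             expansive_measure \<phi> \<nu>))"
proof (intro conjI allI impI)
  show "supp \<mu> \<inter> Sing \<phi> = {}" if "expansive_measure \<phi> \<mu>"
    using assms(2) that by (rule expansive_supp_Sing)
  show "aperiodic_wrt \<phi> \<mu>" if "expansive_measure \<phi> \<mu>"
    using assms that by (rule expansive_aperiodic)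
  show "expansive_measure \<phi> \<mu> \<longleftrightarrow> expansive_measure \<psi> (distr \<mu> borel f)"
    if "continuous_flow \<psi> \<and> flow_equivalence \<phi> \<psi> f"
    for \<psi> :: "real \<Rightarrow> 'b \<Rightarrow> 'b" and f
    using assms(1,2) conjunct1[OF that] conjunct2[OF that] assms(3)
    by (rule expansive_measure_distr_iff)
  show "vanishes_along_orbits \<phi> \<mu>" if "expansive_measure \<phi> \<mu>"
    using assms that by (rule expansive_vanishes_along_orbits)
  show "expansive_measure \<phi> \<nu>"
    if "expansive_flow \<phi>" and "borel_measure \<nu> \<and> vanishes_along_orbits \<phi> \<nu>" for \<nu> :: "'a measure"
    using assms(2) that(1) conjunct2[OF that(2)] by (rule expansive_flow_imp_expansive_measure)
qed

end
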